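(* Let $\bm y^*\in\mathcal{E}$, i.e. $\bm y^*\in\mathbb{R}^N_+$ with $f_i(\bm y^* )=0$ for all $i=1,\dots,N$. Then $\bm\Phi^{h,N_k}(\bm y^* )=\bm y^*$ for every $h>0$, $M\ge0$ and $N_k\ge0$. Equivalently, $\mathcal{E}\subseteq\mathcal{F}^{h,N_k}$.
   Context: Let $\mathbb{R}^N_+=\{\bm\eta\in\mathbb{R}^N:\eta_i>0\ \forall i\}$. Consider $\bm y'(t)=\bm f(\bm y(t))$, $t\in[0,T]$, $\bm y(0)=\bm y_0\in\mathbb{R}^N_+$, where $\bm f=[f_1,\dots,f_N]^\top$ is a sufficiently smooth $\mathbb{R}^N$-valued function defined on an open set containing $\mathbb{R}^N_+$. Standing assumption: $\mathbb{R}^N_+$ is forward invariant under the flow. Let $M\ge0$, $N_k\ge 0$ be integers, $h>0$, and let $0\le\tau_0<\tau_1<\dots<\tau_M=1$ be quadrature nodes with Lagrange basis polynomials $\ell_0,\dots,\ell_M$ (of degree at most $M$). Set $Q_{m,j}=\int_0^{\tau_m}\ell_j(\tau)\,d\tau$ for $m,j=0,\dots,M$. One step of the SPIDeC scheme from $\bm y^n\in\mathbb{R}^N_+$ is, for $i=1,\dots,N$, $m=0,\dots,M$: $$y^{n,m}_{i(0)}=y_i^n\exp\Big(h\tau_m\frac{f_i(\bm y^n)}{y_i^n}\Big),\qquad y^{n,m}_{i(k)}=y_i^n\exp\Big(h\sum_{j=0}^M Q_{m,j}\frac{f_i(\bm y^{n,j}_{(k-1)})}{y^{n,j}_{i(k-1)}}\Big),\quad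 k=1,\dots,N_k,$$ and $y_i^{n+1}=y^{n,M}_{i(N_k)}$. The induced numerical map is $\bm\Phi^{h,N_k}:\mathbb{R}^N_+\to\mathbb{R}^N_+$, $\Phi_i^{h,N_k}(\bm y^n)=y^{n,M}_{i(N_k)}$. $\mathcal{E}=\{\bm y^*\in\mathbb{R}^N_+: f_i(\bm y^* )=0\ \forall i\}$ is the set of equilibria and $\mathcal{F}^{h,N_k}=\{\bm y^*\in\mathbb{R}^N_+:\bm\Phi^{h,N_k}(\bm y^* )=\bm y^*\}$ the set of fixed points of the scheme. *)

theory Defs
  imports "HOL-Analysis.Analysis"
begin

definition pos_orthant :: "(real ^ 'n) set" where
  "pos_orthant = {y. \<forall>i. y $ i > 0}"

definition C1_on :: "(real ^ 'n) set \<Rightarrow> (real ^ 'n \<Rightarrow> real ^ 'n) \<Rightarrow> bool" where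
  "C1_on D f \<longleftrightarrow>
     (\<exists>f' :: real ^ 'n \<Rightarrow> (real ^ 'n) \<Rightarrow>\<^sub>L (real ^ 'n).
        (\<forall>x\<in>D. (f has_derivative blinfun_apply (f' x)) (at x)) \<and> continuous_on D f')"

definition is_solution ::
    "(real ^ 'n) set \<Rightarrow> (real ^ 'n \<Rightarrow> real ^ 'n) \<Rightarrow> real \<Rightarrow> (real \<Rightarrow> real ^ 'n) \<Rightarrow> bool" where
  "is_solution D f T y \<longleftrightarrow>
     (\<forall>t\<in>{0..T}. y t \<in> D \<and> (y has_vector_derivative f (y t)) (at t within {0..T}))"

text \<open>
  A solution need not exist up to a prescribed time: invariance constrains the solutions on
  every interval on which they exist in the domain \<open>D\<close> of the vector field.
\<close>

definition forward_invariant ::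
    "(real ^ 'n) set \<Rightarrow> (real ^ 'n \<Rightarrow> real ^ 'n) \<Rightarrow> (real ^ 'n) set \<Rightarrow> bool" where
  "forward_invariant D f S \<longleftrightarrow>
     (\<forall>T\<ge>0. \<forall>y. is_solution D f T y \<and> y 0 \<in> S \<longrightarrow> (\<forall>t\<in>{0..T}. y t \<in> S))"

text \<open>The nodes \<open>\<tau> 0, \<dots>, \<tau> M\<close>; values of \<open>\<tau>\<close> beyond \<open>M\<close> are never used.\<close>

definition quadrature_nodes :: "nat \<Rightarrow> (nat \<Rightarrow> real) \<Rightarrow> bool" where
  "quadrature_nodes M \<tau> \<longleftrightarrow> 0 \<le> \<tau> 0 \<and> strict_mono_on {0..M} \<tau> \<and> \<tau> M = 1"

definition lagrange_basis :: "nat \<Rightarrow> (nat \<Rightarrow> real) \<Rightarrow> nat \<Rightarrow> real \<Rightarrow> real" where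
  "lagrange_basis M \<tau> j s = (\<Prod>m\<in>{0..M} - {j}. (s - \<tau> m) / (\<tau> j - \<tau> m))"

definition quad_weight :: "nat \<Rightarrow> (nat \<Rightarrow> real) \<Rightarrow> nat \<Rightarrow> nat \<Rightarrow> real" where
  "quad_weight M \<tau> m j = integral {0..\<tau> m} (lagrange_basis M \<tau> j)"

text \<open>
  \<open>spidec_stage f h M \<tau> y k m\<close> is the \<open>m\<close>-th stage of the \<open>k\<close>-th correction sweep of one step
  started at \<open>y\<close>; sweep \<open>0\<close> is the predictor.
\<close>

primrec spidec_stage ::
    "(real ^ 'n \<Rightarrow> real ^ 'n) \<Rightarrow> real \<Rightarrow> nat \<Rightarrow> (nat \<Rightarrow> real) \<Rightarrow> real ^ 'n \<Rightarrow> nat \<Rightarrow> nat \<Rightarrow> real ^ 'n" where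
  "spidec_stage f h M \<tau> y 0 =
     (\<lambda>m. \<chi> i. y $ i * exp (h * \<tau> m * (f y $ i / y $ i)))"
| "spidec_stage f h M \<tau> y (Suc k) =
     (\<lambda>m. \<chi> i. y $ i * exp (h * (\<Sum>j=0..M. quad_weight M \<tau> m j *
        (f (spidec_stage f h M \<tau> y k j) $ i / spidec_stage f h M \<tau> y k j $ i))))"

definition spidec_map ::
    "(real ^ 'n \<Rightarrow> real ^ 'n) \<Rightarrow> real \<Rightarrow> nat \<Rightarrow> (nat \<Rightarrow> real) \<Rightarrow> nat \<Rightarrow> real ^ 'n \<Rightarrow> real ^ 'n" where
  "spidec_map f h M \<tau> Nk y = spidec_stage f h M \<tau> y Nk M"

lemma spidec_stage_pos: "y \<in> pos_orthant \<Longrightarrow> spidec_stage f h M \<tau> y k m \<in> pos_orthant"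
  by (cases k) (simp_all add: pos_orthant_def)

lemma spidec_map_pos: "y \<in> pos_orthant \<Longrightarrow> spidec_map f h M \<tau> Nk y \<in> pos_orthant"
  by (simp add: spidec_map_def spidec_stage_pos)

definition equilibria :: "(real ^ 'n \<Rightarrow> real ^ 'n) \<Rightarrow> (real ^ 'n) set" where
  "equilibria f = {y \<in> pos_orthant. \<forall>i. f y $ i = 0}"

definition spidec_fixed_points ::
    "(real ^ 'n \<Rightarrow> real ^ 'n) \<Rightarrow> real \<Rightarrow> nat \<Rightarrow> (nat \<Rightarrow> real) \<Rightarrow> nat \<Rightarrow> (real ^ 'n) set" where
  "spidec_fixed_points f h M \<tau> Nk = {y \<in> pos_orthant. spidec_map f h M \<tau> Nk y = y}"

end

theory Submission
  imports Defs
begin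

text \<open>
  A stage multiplies the starting value, component by component, by the exponential of a linear
  combination of growth rates \<open>f\<^sub>i / y\<^sub>i\<close>. At a zero of the vector field the predictor sees vanishing
  rates, so every exponential factor is \<open>1\<close> and all its stages stay at the starting value. A sweep
  evaluates the rates at the stages of the preceding sweep, which by induction are that same zero,
  so the quadrature sums in the exponents vanish as well (\<open>spidec_stage_zero\<close>).
\<close>

text \<open>
  The induction on the sweep needs the claim for all stages at once, because each stage of a sweep
  draws on every stage of the preceding one.
\<close>

lemma spidec_stage_zero:
  assumes "f y = 0"
  shows "spidec_stage f h M \<tau> y k m = y"
  by (induction k arbitrary: m) (simp_all add: assms)

lemma spidec_map_equilibrium:
  assumes "y \<in> equilibria f"
  shows "spidec_map f h M \<tau> Nk y = y"
proof -
  have "f y = 0"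
    using assms by (simp add: equilibria_def vec_eq_iff)
  then show ?thesis
    by (simp add: spidec_map_def spidec_stage_zero)
qed

theorem theorem3p2:
  fixes f :: "real ^ 'n \<Rightarrow> real ^ 'n" and D :: "(real ^ 'n) set"
  assumes "open D" and "pos_orthant \<subseteq> D" and "C1_on D f"
    and "forward_invariant D f pos_orthant"
  shows "(\<forall>ystar \<in> equilibria f. \<forall>(h::real) (M::nat) (\<tau>::nat \<Rightarrow> real) (Nk::nat).
            h > 0 \<longrightarrow> quadrature_nodes M \<tau> \<longrightarrow> spidec_map f h M \<tau> Nk ystar = ystar) \<and>
         (\<forall>(h::real) (M::nat) (\<tau>::nat \<Rightarrow> real) (Nk::nat).
            h > 0 \<longrightarrow> quadrature_nodes M \<tau> \<longrightarrow> equilibria f \<subseteq> spidec_fixed_points f h M \<tau> Nk)"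
  by (auto simp: spidec_map_equilibrium spidec_fixed_points_def) (simp add: equilibria_def)

end
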